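(* Let $X=\{x_1,\dots,x_N\}$ be a degenerate configuration of $N$ distinct points on $\mathbb{S}^{d-1}$ with $N\ge d+2$, and let $h:[-1,1]\to\mathbb{R}$ be a strictly convex function. Then there exists a continuous perturbation of $X$ that decreases the $h$-energy $E_h(X)$; that is, there is a continuous family $X(t)=(x_1(t),\dots,x_N(t))\in(\mathbb{S}^{d-1})^N$, $t\in[0,1]$, with $X(0)=(x_1,\dots,x_N)$ and $E_h(X(t))<E_h(X)$ for all $t\in(0,1]$.
   Context: $\mathbb{S}^{d-1}$ is the unit sphere in $\mathbb{R}^d$. For $X=\{x_1,\dots,x_N\}\subset\mathbb{S}^{d-1}$, the $h$-energy is $E_h(X)=\sum_{1\le i\ne j\le N}h(x_i\cdot x_j)$. A configuration $X$ is degenerate if $\mathrm{span}(X)\ne\mathbb{R}^d$. *)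

theory Defs
  imports "HOL-Analysis.Analysis"
begin

definition strictly_convex_on :: "real set \<Rightarrow> (real \<Rightarrow> real) \<Rightarrow> bool" where
  "strictly_convex_on S h \<longleftrightarrow> convex S \<and>
     (\<forall>x\<in>S. \<forall>y\<in>S. \<forall>u. x \<noteq> y \<and> 0 < u \<and> u < 1 \<longrightarrow>
        h ((1 - u) * x + u * y) < (1 - u) * h x + u * h y)"

text \<open>A configuration of \<open>N\<close> points is a family indexed by \<open>{1..N}\<close>, so that points of a
  perturbed configuration may coincide; the sum is over ordered pairs of distinct indices.\<close>

definition h_energy :: "(real \<Rightarrow> real) \<Rightarrow> nat \<Rightarrow> (nat \<Rightarrow> 'a::real_inner) \<Rightarrow> real" where
  "h_energy h N x = (\<Sum>(i, j) \<in> {(i, j). i \<in> {1..N} \<and> j \<in> {1..N} \<and> i \<noteq> j}. h (x i \<bullet> x j))"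

definition degenerate :: "'a::real_vector set \<Rightarrow> bool" where
  "degenerate X \<longleftrightarrow> span X \<noteq> UNIV"

end

theory Submission
  imports Defs
begin

text \<open>
  The configuration lies in a hyperplane; let \<open>f\<close> be a unit normal.
  Take two of the points, \<open>a\<close> and \<open>b\<close>, and rotate the segment between them about its midpoint
  into the direction \<open>f\<close>. Such a rotation keeps both points on the sphere (the midpoint is
  orthogonal to \<open>b - a\<close> and to \<open>f\<close>) and keeps \<open>a \<bullet> b\<close> unchanged. Every other point \<open>v\<close> is
  orthogonal to \<open>f\<close>, so it only sees the orthogonal projections of the moved points, which slide
  along the segment towards each other: the pair of numbers \<open>a \<bullet> v\<close>, \<open>b \<bullet> v\<close> is replaced by
  \<open>(1 - \<mu>) (a \<bullet> v) + \<mu> (b \<bullet> v)\<close> and \<open>(1 - \<mu>) (b \<bullet> v) + \<mu> (a \<bullet> v)\<close>. By convexity this does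
  not increase \<open>h (a \<bullet> v) + h (b \<bullet> v)\<close>, and it strictly decreases that sum if
  \<open>a \<bullet> v \<noteq> b \<bullet> v\<close>. Since this compares actual values of \<open>h\<close> and not derivatives, the energy
  is below its initial value along the whole motion.

  It remains to choose \<open>a\<close>, \<open>b\<close> such that some third point \<open>v\<close> has different inner products
  with them. If there were no such triple, the points would be the vertices of a regular simplex.
  However, \<open>d + 2\<close> points of \<open>d\<close>-dimensional space are affinely dependent, and an affine
  dependency rules this out (\<open>unit_vectors_distinguishing_triple\<close>).
\<close>

section \<open>Two convexity inequalities\<close>

lemma strictly_convex_on_exchange_less:
  assumes "strictly_convex_on S h" "a \<in> S" "b \<in> S" "a \<noteq> b" "0 < u" "u < 1"
  shows "h ((1 - u) * a + u * b) + h ((1 - u) * b + u * a) < h a + h b"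
proof -
  have "h ((1 - u) * a + u * b) < (1 - u) * h a + u * h b"
    and "h ((1 - u) * b + u * a) < (1 - u) * h b + u * h a"
    using assms unfolding strictly_convex_on_def by auto
  then show ?thesis
    by (simp add: algebra_simps)
qed

lemma strictly_convex_on_exchange_le:
  assumes "strictly_convex_on S h" "a \<in> S" "b \<in> S" "0 < u" "u < 1"
  shows "h ((1 - u) * a + u * b) + h ((1 - u) * b + u * a) \<le> h a + h b"
proof (cases "a = b")
  case True
  then show ?thesis by (simp add: algebra_simps)
next
  case False
  then show ?thesis
    using strictly_convex_on_exchange_less[of S h a b u] assms by simp
qed

section \<open>Unit vectors that do not form a simplex\<close>

text \<open>
  Suppose that, for a fixed \<open>v\<close>, all \<open>w \<noteq> v\<close> in \<open>S\<close> have the same inner product \<open>\<rho> < 1\<close> with \<open>v\<close>.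
  Pairing an affine dependency \<open>\<Sum> c w = 0\<close>, \<open>\<Sum> c w *\<^sub>R w = 0\<close> with \<open>v\<close> then gives
  \<open>c v * (1 - \<rho>) = 0\<close>. So this must fail for any \<open>v\<close> in the support of the dependency.
\<close>

lemma unit_vectors_distinguishing_triple:
  fixes S :: "'a::euclidean_space set"
  assumes fin: "finite S" and unit: "\<And>w. w \<in> S \<Longrightarrow> norm w = 1"
    and card: "card S \<ge> DIM('a) + 2"
  obtains a b v where "a \<in> S" "b \<in> S" "v \<in> S" "a \<noteq> v" "b \<noteq> v" "a \<bullet> v \<noteq> b \<bullet> v"
proof -
  have "affine_dependent S"
    using affine_dependent_biggerset[OF fin card] .
  then obtain c v where c: "sum c S = 0" "v \<in> S" "c v \<noteq> 0" "(\<Sum>w\<in>S. c w *\<^sub>R w) = 0"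
    using affine_dependent_explicit_finite[OF fin] by blast
  have "S - {v} \<noteq> {}"
  proof
    assume "S - {v} = {}"
    then have "S \<subseteq> {v}" by blast
    then have "card S \<le> 1" using card_mono[of "{v}" S] by simp
    then show False using card by simp
  qed
  then obtain b where b: "b \<in> S" "b \<noteq> v" by blast
  have "\<exists>a\<in>S - {v}. a \<bullet> v \<noteq> b \<bullet> v"
  proof (rule ccontr)
    assume "\<not> ?thesis"
    then have const: "a \<bullet> v = b \<bullet> v" if "a \<in> S - {v}" for a
      using that by blast
    have "0 = (\<Sum>w\<in>S. c w *\<^sub>R w) \<bullet> v"
      using c(4) by simp
    also have "\<dots> = (\<Sum>w\<in>S. c w * (w \<bullet> v))"
      by (simp add: inner_sum_left)
    also have "\<dots> = c v * (v \<bullet> v) + (\<Sum>w\<in>S - {v}. c w * (w \<bullet> v))"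
      using fin c(2) by (simp add: sum.remove)
    also have "\<dots> = c v * (v \<bullet> v) + sum c (S - {v}) * (b \<bullet> v)"
      using const by (simp add: sum_distrib_right)
    also have "\<dots> = c v * (1 - b \<bullet> v)"
    proof -
      have "sum c (S - {v}) = - c v"
        using c(1,2) fin by (simp add: sum.remove)
      moreover have "v \<bullet> v = 1"
        using unit[OF c(2)] by (simp add: norm_eq_1)
      ultimately show ?thesis by (simp add: algebra_simps)
    qed
    finally have "b \<bullet> v = 1"
      using c(3) by simp
    moreover have "(norm (b - v))\<^sup>2 = 2 - 2 * (b \<bullet> v)"
      using unit[OF b(1)] unit[OF c(2)]
      by (simp add: power2_norm_eq_inner inner_diff inner_commute norm_eq_1)
    ultimately show False
      using b(2) by simp
  qed
  then show ?thesis
    using that b c(2) by blast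
qed

section \<open>The part of the energy that involves two given points\<close>

lemma h_energy_split_pair:
  fixes y :: "nat \<Rightarrow> 'a::real_inner"
  assumes k: "k \<in> {1..N}" and l: "l \<in> {1..N}" and kl: "k \<noteq> l"
  defines "J \<equiv> {1..N} - {k, l}"
  shows "h_energy h N y =
    (\<Sum>i\<in>J. \<Sum>j\<in>J - {i}. h (y i \<bullet> y j)) + 2 * h (y k \<bullet> y l)
      + 2 * (\<Sum>j\<in>J. h (y k \<bullet> y j) + h (y l \<bullet> y j))"
proof -
  let ?g = "\<lambda>i j. h (y i \<bullet> y j)"
  have I: "{1..N} = insert k (insert l J)" and J: "finite J" "k \<notin> J" "l \<notin> J"
    using k l by (auto simp: J_def)
  have "h_energy h N y = (\<Sum>(i, j)\<in>(SIGMA i:{1..N}. {1..N} - {i}). ?g i j)"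
    unfolding h_energy_def by (rule sum.cong) auto
  also have "\<dots> = (\<Sum>i\<in>{1..N}. \<Sum>j\<in>{1..N} - {i}. ?g i j)"
    by (simp add: sum.Sigma)
  also have "\<dots> = (\<Sum>j\<in>insert l J. ?g k j) + ((\<Sum>j\<in>insert k J. ?g l j)
      + (\<Sum>i\<in>J. \<Sum>j\<in>insert k (insert l (J - {i})). ?g i j))"
  proof -
    let ?r = "\<lambda>i. \<Sum>j\<in>{1..N} - {i}. ?g i j"
    have "{1..N} - {k} = insert l J" "{1..N} - {l} = insert k J"
      using I J kl by auto
    moreover have "{1..N} - {i} = insert k (insert l (J - {i}))" if "i \<in> J" for i
      using I J that by auto
    moreover have "sum ?r {1..N} = ?r k + (?r l + sum ?r J)"
      using J kl by (subst I) (simp del: One_nat_def)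
    ultimately show ?thesis
      by (simp only: cong: sum.cong)
  qed
  also have "\<dots> = (\<Sum>i\<in>J. \<Sum>j\<in>J - {i}. ?g i j) + 2 * ?g k l
      + 2 * (\<Sum>j\<in>J. ?g k j + ?g l j)"
  proof -
    have "?g i k = ?g k i" "?g i l = ?g l i" if "i \<in> J" for i
      by (simp_all add: inner_commute)
    moreover have "?g l k = ?g k l"
      by (simp add: inner_commute)
    ultimately show ?thesis
      using J kl by (simp add: sum.distrib)
  qed
  finally show ?thesis .
qed

section \<open>The rotation of a pair of points\<close>

text \<open>
  With \<open>u = (1 - cos \<phi>) / 2\<close>, the point \<open>pair_rotation f a b u\<close> is the image of \<open>a\<close> under
  the rotation by the angle \<open>\<phi>\<close> about the midpoint of \<open>a\<close> and \<open>b\<close> in the plane of \<open>b - a\<close> and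
  the unit normal \<open>f\<close>. The image of \<open>b\<close> under the same rotation is
  \<open>pair_rotation (- f) b a u\<close>. The parameter \<open>u\<close> is the weight with which the projections
  are averaged, and the factor \<open>sqrt (u * (1 - u))\<close> is \<open>(sin \<phi>) / 2\<close>.
\<close>

definition pair_rotation :: "'a::real_inner \<Rightarrow> 'a \<Rightarrow> 'a \<Rightarrow> real \<Rightarrow> 'a" where
  "pair_rotation f a b u =
     (1 - u) *\<^sub>R a + u *\<^sub>R b + (sqrt (u * (1 - u)) * norm (a - b)) *\<^sub>R f"

lemma pair_rotation_0 [simp]: "pair_rotation f a b 0 = a"
  by (simp add: pair_rotation_def)

lemma continuous_on_pair_rotation:
  assumes "continuous_on A g"
  shows "continuous_on A (\<lambda>t. pair_rotation f a b (g t))"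
  using assms unfolding pair_rotation_def by (intro continuous_intros)

lemma inner_pair_rotation:
  assumes "f \<bullet> v = 0"
  shows "pair_rotation f a b u \<bullet> v = (1 - u) * (a \<bullet> v) + u * (b \<bullet> v)"
  using assms by (simp add: pair_rotation_def inner_add_left)

context
  fixes a b f :: "'a::real_inner" and u :: real
  assumes norms: "norm a = 1" "norm b = 1" "norm f = 1"
    and orth: "f \<bullet> a = 0" "f \<bullet> b = 0"
    and u: "0 \<le> u" "u \<le> 1"
begin

text \<open>
  The component along \<open>f\<close> restores the unit length: the right-hand side is
  \<open>1 - (norm ((1 - u) *\<^sub>R a + u *\<^sub>R b))\<^sup>2\<close>.
\<close>

lemma pair_rotation_height_square:
  "(sqrt (u * (1 - u)) * norm (a - b)) * (sqrt (u * (1 - u)) * norm (a - b))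
     = 2 * u * (1 - u) * (1 - a \<bullet> b)"
proof -
  have "(sqrt (u * (1 - u)))\<^sup>2 = u * (1 - u)"
    using u by simp
  moreover have "(norm (a - b))\<^sup>2 = 2 * (1 - a \<bullet> b)"
    using norms by (simp add: power2_norm_eq_inner inner_diff inner_commute norm_eq_1)
  ultimately have "(sqrt (u * (1 - u)) * norm (a - b))\<^sup>2 = u * (1 - u) * (2 * (1 - a \<bullet> b))"
    by (simp only: power_mult_distrib)
  also have "\<dots> = 2 * u * (1 - u) * (1 - a \<bullet> b)"
    by simp
  finally show ?thesis
    by (simp only: power2_eq_square)
qed

lemma norm_pair_rotation: "norm (pair_rotation f a b u) = 1"
proof -
  define r where "r = sqrt (u * (1 - u)) * norm (a - b)"
  have inners: "a \<bullet> a = 1" "b \<bullet> b = 1" "f \<bullet> f = 1" "b \<bullet> a = a \<bullet> b" "a \<bullet> f = 0" "b \<bullet> f = 0"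
    using norms orth by (simp_all add: norm_eq_1 inner_commute)
  have "pair_rotation f a b u \<bullet> pair_rotation f a b u
      = (1 - u) * (1 - u) + u * u + 2 * u * (1 - u) * (a \<bullet> b) + r * r"
    unfolding pair_rotation_def r_def[symmetric]
    by (simp add: inner_add_left inner_add_right inners orth)
      (simp add: algebra_simps)
  also have "\<dots> = 1"
    unfolding r_def pair_rotation_height_square by (simp add: algebra_simps)
  finally show ?thesis
    by (simp add: norm_eq_1)
qed

lemma inner_pair_rotation_pair:
  "pair_rotation f a b u \<bullet> pair_rotation (- f) b a u = a \<bullet> b"
proof -
  define r where "r = sqrt (u * (1 - u)) * norm (a - b)"
  have inners: "a \<bullet> a = 1" "b \<bullet> b = 1" "f \<bullet> f = 1" "b \<bullet> a = a \<bullet> b" "a \<bullet> f = 0" "b \<bullet> f = 0"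
    using norms orth by (simp_all add: norm_eq_1 inner_commute)
  have "pair_rotation f a b u \<bullet> pair_rotation (- f) b a u
      = ((1 - u) * (1 - u) + u * u) * (a \<bullet> b) + 2 * u * (1 - u) - r * r"
    unfolding pair_rotation_def norm_minus_commute[of b a] r_def[symmetric]
    by (simp add: inner_add_left inner_diff_right inner_add_right inners orth)
      (simp add: algebra_simps)
  also have "\<dots> = a \<bullet> b"
    unfolding r_def pair_rotation_height_square by (simp add: algebra_simps)
  finally show ?thesis .
qed

end

section \<open>Degenerate configurations are not local minimizers\<close>

theorem theorem2p3:
  fixes x :: "nat \<Rightarrow> real ^ 'd" and N :: nat and h :: "real \<Rightarrow> real"
  assumes "\<forall>i\<in>{1..N}. x i \<in> sphere 0 1"
    and "inj_on x {1..N}"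
    and "degenerate (x ` {1..N})"
    and "N \<ge> CARD('d) + 2"
    and "strictly_convex_on {-1..1} h"
  shows "\<exists>X :: real \<Rightarrow> nat \<Rightarrow> real ^ 'd.
    (\<forall>i\<in>{1..N}. continuous_on {0..1} (\<lambda>t. X t i)) \<and>
    (\<forall>t\<in>{0..1}. \<forall>i\<in>{1..N}. X t i \<in> sphere 0 1) \<and>
    (\<forall>i\<in>{1..N}. X 0 i = x i) \<and>
    (\<forall>t\<in>{0<..1}. h_energy h N (X t) < h_energy h N x)"
proof -
  have unit: "norm (x i) = 1" if "i \<in> {1..N}" for i
    using assms(1) that by simp
  obtain f0 where f0: "f0 \<noteq> 0" "\<forall>v\<in>span (x ` {1..N}). f0 \<bullet> v = 0"
    using span_not_UNIV_orthogonal[of "x ` {1..N}"] assms(3) unfolding degenerate_def by blast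
  define f where "f = f0 /\<^sub>R norm f0"
  have f: "norm f = 1" "\<And>i. i \<in> {1..N} \<Longrightarrow> f \<bullet> x i = 0"
    using f0 by (auto simp: f_def span_base)

  have "card (x ` {1..N}) \<ge> DIM(real ^ 'd) + 2"
    using assms(2,4) by (simp add: card_image)
  then obtain a b v where abv: "a \<in> x ` {1..N}" "b \<in> x ` {1..N}" "v \<in> x ` {1..N}"
    "a \<noteq> v" "b \<noteq> v" "a \<bullet> v \<noteq> b \<bullet> v"
    using unit_vectors_distinguishing_triple[of "x ` {1..N}"] unit by blast
  then obtain k l m where "k \<in> {1..N}" "l \<in> {1..N}" "m \<in> {1..N}" "a = x k" "b = x l" "v = x m"
    by (elim imageE)
  then have km: "k \<in> {1..N}" "l \<in> {1..N}" "m \<in> {1..N}" "m \<noteq> k" "m \<noteq> l"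
    and neq: "x k \<bullet> x m \<noteq> x l \<bullet> x m"
    using abv by auto
  then have kl: "k \<noteq> l" by auto

  \<comment> \<open>The weight stays in \<open>[0, 1/2]\<close>: at weight \<open>1\<close> the two points would have
    changed places and the energy would be back at its initial value.\<close>
  define X where "X = (\<lambda>t i. if i = k then pair_rotation f (x k) (x l) (t / 2)
     else if i = l then pair_rotation (- f) (x l) (x k) (t / 2) else x i)"

  have "continuous_on {0..1} (\<lambda>t. X t i)" for i
    by (cases "i = k"; cases "i = l")
      (simp_all add: X_def continuous_on_pair_rotation continuous_on_divide)
  moreover have "X t i \<in> sphere 0 1" if "t \<in> {0..1}" "i \<in> {1..N}" for t i
    using that km f unit by (simp add: X_def norm_pair_rotation)
  moreover have "X 0 i = x i" for i
    by (simp add: X_def)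
  moreover have "h_energy h N (X t) < h_energy h N x" if t: "t \<in> {0<..1}" for t
  proof -
    define J where "J = {1..N} - {k, l}"
    have XJ: "X t j = x j" if "j \<in> J" for j
      using that by (auto simp: X_def J_def)
    have Xkl: "X t k \<bullet> X t l = x k \<bullet> x l"
      using t km f unit kl by (simp add: X_def inner_pair_rotation_pair)
    have mem: "x i \<bullet> x j \<in> {-1..1}" if "i \<in> {1..N}" "j \<in> {1..N}" for i j
      using Cauchy_Schwarz_ineq2[of "x i" "x j"] unit that by auto
    have Xj: "X t k \<bullet> X t j = (1 - t / 2) * (x k \<bullet> x j) + t / 2 * (x l \<bullet> x j)"
             "X t l \<bullet> X t j = (1 - t / 2) * (x l \<bullet> x j) + t / 2 * (x k \<bullet> x j)"
      if "j \<in> J" for j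
      using that kl f by (auto simp: X_def J_def inner_pair_rotation)
    have "(\<Sum>j\<in>J. h (X t k \<bullet> X t j) + h (X t l \<bullet> X t j))
        < (\<Sum>j\<in>J. h (x k \<bullet> x j) + h (x l \<bullet> x j))"
    proof (rule sum_strict_mono_ex1)
      show "finite J" by (simp add: J_def)
      show "\<forall>j\<in>J. h (X t k \<bullet> X t j) + h (X t l \<bullet> X t j) \<le> h (x k \<bullet> x j) + h (x l \<bullet> x j)"
      proof
        fix j assume "j \<in> J"
        then show "h (X t k \<bullet> X t j) + h (X t l \<bullet> X t j) \<le> h (x k \<bullet> x j) + h (x l \<bullet> x j)"
          unfolding Xj[OF \<open>j \<in> J\<close>]
          using strictly_convex_on_exchange_le[OF assms(5) mem mem, of k j l j "t / 2"] t km
          by (simp add: J_def)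
      qed
      have "m \<in> J" using km by (simp add: J_def)
      moreover have "h (X t k \<bullet> X t m) + h (X t l \<bullet> X t m) < h (x k \<bullet> x m) + h (x l \<bullet> x m)"
        unfolding Xj[OF \<open>m \<in> J\<close>]
        using strictly_convex_on_exchange_less[OF assms(5) mem mem neq, of "t / 2"] t km by simp
      ultimately show "\<exists>j\<in>J. h (X t k \<bullet> X t j) + h (X t l \<bullet> X t j)
          < h (x k \<bullet> x j) + h (x l \<bullet> x j)"
        by blast
    qed
    moreover have "(\<Sum>i\<in>J. \<Sum>j\<in>J - {i}. h (X t i \<bullet> X t j))
        = (\<Sum>i\<in>J. \<Sum>j\<in>J - {i}. h (x i \<bullet> x j))"
      by (simp add: XJ)
    ultimately show ?thesis
      unfolding h_energy_split_pair[OF km(1,2) kl] J_def[symmetric] Xkl by linarith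
  qed
  ultimately show ?thesis
    by (intro exI[of _ X]) blast
qed

end
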